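(* Let $\Gamma$ be a directed graph with countably many vertices and with bounded cycles. Let $r$ be its growth rate, let $K(\Gamma,n)$ be the number of multi-cycles of length $n$ in $\Gamma$, and let $\sigma := \limsup_{n} \sqrt[n]{K(\Gamma,n)}$. Suppose $\sigma\le 1$. Then the formula $$P(z) := \sum_{\gamma \text{ multi-cycle}} (-1)^{C(\gamma)}\, z^{\ell(\gamma)}$$ defines a holomorphic function $P(z)$ in the unit disk $|z|<1$, and moreover $P(z)$ is non-zero in the disk $|z|<r^{-1}$; if $r>1$, we also have $P(r^{-1})=0$.
   Context: Graphs are directed: a countable (finite or infinite) set $V$ of vertices and a set $E$ of edges, each edge $e$ having a source $s(e)\in V$ and a target $t(e)\in V$; loops and multiple edges are allowed. The outgoing degree of a vertex $v$ is the number of edges with source $v$. A closed path of length $n\ge 1$ based at $v$ is a sequence $(e_1,\dots,e_n)$ of edges with $t(e_i)=s(e_{i+1})$ for $1\le i\le n-1$ and $t(e_n)=s(e_1)=v$; it may self-intersect, and closed paths with different starting vertices are considered different. A simple cycle is a closed path with $s(e_i)\ne s(e_j)$ for $i\neq j$, considered up to cyclic permutation of its edges. The support of a cycle is the set of vertices it visits. A multi-cycle $\gamma$ is a union of finitely many simple cycles with pairwise disjoint supports; $C(\gamma)$ is the number of its components and $\ell(\gamma)$ (its length) is the sum of the lengths of its components. The empty multi-cycle, with $C=0$ and $\ell=0$, is included. $\Gamma$ has bounded cycles if there is a uniform finite upper bound on the outgoing degrees of its vertices and, for each positive integer $n$, there are at most finitely many simple cycles of length $n$ in $\Gamma$. Then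 the number $C(\Gamma,n)$ of closed paths of length $n$ is finite for every $n$, and the growth rate is $r=r(\Gamma):=\limsup_n \sqrt[n]{C(\Gamma,n)}$. If $r=0$, then $r^{-1}$ is understood as $+\infty$. *)

theory Defs
  imports "HOL-Complex_Analysis.Complex_Analysis" "Graph_Theory.Arc_Walk"
begin

text \<open>
  Directed graphs are AFP digraphs: \<^term>\<open>tail G e\<close> is the source of the edge \<^term>\<open>e\<close> and
  \<^term>\<open>head G e\<close> its target; loops and multiple edges are allowed. Paths are lists of arcs.
  The base point of a non-empty closed path is the tail of its first arc, so the arc list
  already distinguishes closed paths with different base points.
\<close>

definition closed_paths :: "('a, 'b) pre_digraph \<Rightarrow> nat \<Rightarrow> 'b list set" where
  "closed_paths G n = {p. p \<noteq> [] \<and> length p = n \<and> (\<exists>v. pre_digraph.awalk G v p v)}"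

text \<open>
  A simple cycle is a whole class of arc lists modulo cyclic permutation.
\<close>

definition simple_cycles :: "('a, 'b) pre_digraph \<Rightarrow> 'b list set set" where
  "simple_cycles G = {range (\<lambda>k. rotate k p) | p. pre_digraph.cycle G p}"

lemma cycle_iff_distinct_sources:
  "pre_digraph.cycle G p \<longleftrightarrow> p \<in> closed_paths G (length p) \<and> distinct (map (tail G) p)"
proof -
  interpret pre_digraph G .
  have *: "distinct (tl (awalk_verts u p)) \<longleftrightarrow> distinct (map (tail G) p)"
    if "awalk u p u" "p \<noteq> []" for u
  proof -
    have c: "cas u p u"
      using that by (simp add: awalk_def)
    have h: "tail G (hd p) = u"
      using c that by (simp add: cas_simp)
    have l: "cas v q w \<Longrightarrow> q \<noteq> [] \<Longrightarrow> head G (last q) = w" for v q w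
      by (induction v q w rule: cas.induct) auto
    have "awalk_verts u p = map (tail G) p @ [u]"
      using l[OF c] that by (simp add: awalk_verts_conv)
    then show ?thesis
      using that h by (cases p) auto
  qed
  show ?thesis
    unfolding cycle_def closed_paths_def using * by auto
qed

text \<open>
  All representatives of a cycle have the same length and visit the same vertices; see the
  two lemmas below.
\<close>

definition cycle_length :: "'b list set \<Rightarrow> nat" where
  "cycle_length c = length (SOME p. p \<in> c)"

definition cycle_support :: "('a, 'b) pre_digraph \<Rightarrow> 'b list set \<Rightarrow> 'a set" where
  "cycle_support G c = {tail G e | e p. p \<in> c \<and> e \<in> set p}"

lemma cycle_length_rotations: "cycle_length (range (\<lambda>k. rotate k p)) = length p"
proof -
  have "p \<in> range (\<lambda>k. rotate k p)"
    by (rule range_eqI[of _ _ 0]) simp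
  then have "(SOME q. q \<in> range (\<lambda>k. rotate k p)) \<in> range (\<lambda>k. rotate k p)"
    by (rule someI)
  then show ?thesis
    unfolding cycle_length_def by (metis imageE length_rotate)
qed

lemma cycle_support_rotations: "cycle_support G (range (\<lambda>k. rotate k p)) = tail G ` set p"
  by (auto simp: cycle_support_def)

text \<open>
  A multi-cycle is represented by the set of its components. The set is determined by the
  union of the components, since their supports are pairwise disjoint.
\<close>

definition multi_cycles :: "('a, 'b) pre_digraph \<Rightarrow> 'b list set set set" where
  "multi_cycles G =
    {\<gamma>. finite \<gamma> \<and> \<gamma> \<subseteq> simple_cycles G \<and> disjoint_family_on (cycle_support G) \<gamma>}"

definition multi_cycle_length :: "'b list set set \<Rightarrow> nat" where
  "multi_cycle_length \<gamma> = (\<Sum>c\<in>\<gamma>. cycle_length c)"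

definition bounded_cycles :: "('a, 'b) pre_digraph \<Rightarrow> bool" where
  "bounded_cycles G \<longleftrightarrow>
    (\<exists>D. \<forall>v\<in>verts G. finite (out_arcs G v) \<and> out_degree G v \<le> D) \<and>
    (\<forall>n\<ge>1. finite {c \<in> simple_cycles G. cycle_length c = n})"

text \<open>
  The following two limits are taken in the extended reals, so no finiteness of the limit is
  presupposed. In a graph with bounded cycles the sets that are counted are finite, so that
  \<^const>\<open>card\<close> is the true number of elements.
\<close>

definition growth_rate :: "('a, 'b) pre_digraph \<Rightarrow> ereal" where
  "growth_rate G = limsup (\<lambda>n. ereal (root n (real (card (closed_paths G n)))))"

definition multi_cycle_growth_rate :: "('a, 'b) pre_digraph \<Rightarrow> ereal" where
  "multi_cycle_growth_rate G =
    limsup (\<lambda>n. ereal (root n (real (card {\<gamma> \<in> multi_cycles G. multi_cycle_length \<gamma> = n}))))"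

definition multi_cycle_term :: "complex \<Rightarrow> 'b list set set \<Rightarrow> complex" where
  "multi_cycle_term z \<gamma> = (- 1) ^ card \<gamma> * z ^ multi_cycle_length \<gamma>"

definition multi_cycle_series :: "('a, 'b) pre_digraph \<Rightarrow> complex \<Rightarrow> complex" where
  "multi_cycle_series G z = (\<Sum>\<^sub>\<infinity>\<gamma>\<in>multi_cycles G. multi_cycle_term z \<gamma>)"

end

theory Submission
  imports Defs
begin

text \<open>
  Write \<open>p\<^sub>n\<close> for the signed number of multi-cycles of length \<open>n\<close> and \<open>c\<^sub>n\<close> for the number of closed
  paths of length \<open>n\<close>. For a finite graph with adjacency matrix \<open>A\<close> the series \<open>P\<close> is
  \<open>det (1 - z A)\<close> and \<open>c\<^sub>n\<close> is the trace of \<open>A\<^sup>n\<close>, so \<open>P(z) = exp (- F(z))\<close> with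
  \<open>F(z) = \<Sum>n\<ge>1. c\<^sub>n z\<^sup>n / n\<close>. There is no determinant for an infinite graph, but the identity is
  equivalent to Newton's identities \<open>n p\<^sub>n + (\<Sum>k\<le>n. c\<^sub>k p\<^bsub>n-k\<^esub>) = 0\<close>, and these have a bijective
  proof (\<open>newton_identity\<close>) that only involves finitely many paths at a time.

  The bijective proof is a sign-reversing cancellation on pairs of a multi-cycle \<open>\<gamma>\<close> and a closed
  path \<open>p\<close>. Walk along \<open>p\<close> until one of two things happens: the path meets the support of
  \<open>\<gamma>\<close>, or it returns to one of its own vertices. In the first case the component of \<open>\<gamma>\<close> that was
  met is taken out of \<open>\<gamma>\<close> and spliced into \<open>p\<close>; in the second case the loop of \<open>p\<close> that has just
  been closed is taken out of \<open>p\<close> and added to \<open>\<gamma>\<close>. The two operations are inverse to each other and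
  change the number of components by one. The second one is impossible only if the loop is all
  of \<open>p\<close>, so what survives are the pairs in which \<open>p\<close> is a simple cycle disjoint from \<open>\<gamma>\<close>.
  These are multi-cycles of length \<open>n\<close> with a marked vertex, and there are \<open>n\<close> choices for the mark.

  In analytic terms Newton's identities say \<open>P' = - P F'\<close>. The assumption on the growth of multi-cycles
  makes \<open>P\<close> a power series of radius at least \<open>1\<close>, while the radius of \<open>F\<close> is exactly \<open>1 / r\<close>.
  Hence \<open>P = exp (- F)\<close> has no zero in the intersection of the two discs
  (\<open>fps_mult_exp_eq_1\<close>). If \<open>1 / r > 1\<close>, a closed path could not be repeated arbitrarily often, so there
  are no cycles at all and \<open>P = 1\<close>. If \<open>R = 1 / r < 1\<close> and \<open>P(R)\<close> were non-zero, then, since \<open>F\<close> has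
  non-negative coefficients, \<open>\<bar>P(z)\<bar> = exp (- Re F(z)) \<ge> P(\<bar>z\<bar>)\<close> would keep \<open>P\<close> away from zero on the
  closed disc of radius \<open>R\<close>; so \<open>1 / P\<close>, and with it \<open>F' = - P' / P\<close>, would be holomorphic on a larger
  disc, contradicting that \<open>F'\<close> has radius \<open>R\<close> (\<open>eval_fps_zero_at_conv_radius\<close>). This replaces an
  appeal to Pringsheim's theorem.
\<close>

section \<open>Power series with P' = - P F'\<close>

lemma conv_radius_mono_norm:
  assumes "\<And>n. norm (f n) \<le> norm (g n)"
  shows "conv_radius g \<le> conv_radius f"
  unfolding conv_radius_def
proof (rule ereal_inverse_antimono)
  have "0 = limsup (\<lambda>n. 0 :: ereal)" by (simp add: Limsup_const)
  also have "\<dots> \<le> limsup (\<lambda>n. ereal (root n (norm (f n))))"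
    by (intro Limsup_mono) (simp add: real_root_ge_zero)
  finally show "0 \<le> limsup (\<lambda>n. ereal (root n (norm (f n))))" .
  show "limsup (\<lambda>n. ereal (root n (norm (f n)))) \<le> limsup (\<lambda>n. ereal (root n (norm (g n))))"
  proof (intro Limsup_mono always_eventually allI)
    fix n show "ereal (root n (norm (f n))) \<le> ereal (root n (norm (g n)))"
      by (cases "n = 0") (use assms in \<open>auto intro: real_root_le_mono\<close>)
  qed
qed

text \<open>
  The differential equation says that the derivative of \<open>P exp F\<close> vanishes.
\<close>

lemma fps_mult_exp_eq_1:
  fixes P F :: "complex fps"
  assumes P0: "fps_nth P 0 = 1" and F0: "fps_nth F 0 = 0"
    and ode: "fps_deriv P = - (P * fps_deriv F)"
    and zP: "ereal (norm z) < fps_conv_radius P" and zF: "ereal (norm z) < fps_conv_radius F"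
  shows "eval_fps P z * exp (eval_fps F z) = 1"
proof -
  let ?g = "\<lambda>w. eval_fps P w * exp (eval_fps F w)"
  have "(?g has_field_derivative 0) (at w within cball 0 (norm z))" if "w \<in> cball 0 (norm z)" for w
  proof -
    have w: "ereal (norm w) \<le> ereal (norm z)" using that by simp
    have wP: "ereal (norm w) < fps_conv_radius P" and wF: "ereal (norm w) < fps_conv_radius F"
      using w zP zF by (metis le_less_trans)+
    have wF': "ereal (norm w) < fps_conv_radius (fps_deriv F)"
      using wF fps_conv_radius_deriv[of F] by (metis less_le_trans)
    have "eval_fps (fps_deriv P) w = - (eval_fps P w * eval_fps (fps_deriv F) w)"
    proof -
      have "ereal (norm w) < fps_conv_radius (P * fps_deriv F)"
        using wP wF' fps_conv_radius_mult[of P "fps_deriv F"] by (metis less_le_trans min_less_iff_conj)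
      then show ?thesis
        unfolding ode by (simp add: eval_fps_minus eval_fps_mult wP wF')
    qed
    then show ?thesis
      by (auto intro!: derivative_eq_intros has_field_derivative_eval_fps wP wF)
  qed
  then obtain k where k: "\<And>w. w \<in> cball 0 (norm z) \<Longrightarrow> ?g w = k"
    using has_field_derivative_zero_constant[OF convex_cball, of 0 "norm z" ?g] by blast
  have "k = 1" using k[of 0] P0 F0 by (simp add: eval_fps_at_0)
  then show ?thesis using k[of z] by simp
qed

lemma norm_eval_fps_le_eval_fps_norm:
  fixes F :: "complex fps"
  assumes F: "\<And>n. fps_nth F n = of_real (f n)" and f: "\<And>n. f n \<ge> 0"
    and z: "ereal (norm z) < fps_conv_radius F"
  shows "norm (eval_fps F z) \<le> Re (eval_fps F (of_real (norm z)))"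
proof -
  have sm: "summable (\<lambda>n. norm (fps_nth F n * z ^ n))"
    using abs_summable_in_conv_radius[of z "fps_nth F"] z by (simp add: fps_conv_radius_def)
  have eq: "norm (fps_nth F n * z ^ n) = f n * norm z ^ n" for n
    using f by (simp add: F norm_mult norm_power)
  have "norm (eval_fps F z) \<le> (\<Sum>n. f n * norm z ^ n)"
    using summable_norm[OF sm] unfolding eq eval_fps_def .
  moreover have "eval_fps F (of_real (norm z)) = of_real (\<Sum>n. f n * norm z ^ n)"
  proof -
    have "(\<lambda>n. complex_of_real (f n * norm z ^ n)) sums of_real (\<Sum>n. f n * norm z ^ n)"
      by (intro sums_of_real summable_sums) (use sm in \<open>simp add: eq\<close>)
    then show ?thesis by (simp add: eval_fps_def F sums_iff)
  qed
  ultimately show ?thesis by simp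
qed

text \<open>
  If \<open>P\<close> did not vanish at \<open>R\<close>, then \<open>P\<close> would be zero-free on the whole closed disc: among the
  points of a given modulus, \<open>\<bar>P\<bar>\<close> is smallest on the positive axis, because \<open>F\<close> has non-negative
  coefficients. By compactness \<open>P\<close> would be zero-free on a larger disc, and
  \<open>F' = - P' / P\<close> would converge there.
\<close>

lemma eval_fps_zero_at_conv_radius:
  fixes P F :: "complex fps"
  assumes P0: "fps_nth P 0 = 1" and F0: "fps_nth F 0 = 0"
    and ode: "fps_deriv P = - (P * fps_deriv F)"
    and F: "\<And>n. fps_nth F n = of_real (f n)" and f: "\<And>n. f n \<ge> 0"
    and R: "fps_conv_radius F = ereal R" "fps_conv_radius (fps_deriv F) = ereal R"
    and RP: "ereal R < fps_conv_radius P"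
  shows "eval_fps P (of_real R) = 0"
proof (rule ccontr)
  assume nz: "eval_fps P (of_real R) \<noteq> 0"
  have iP: "inverse P * P = 1" by (rule inverse_mult_eq_1) (simp add: P0)
  have F': "fps_deriv F = - (fps_deriv P * inverse P)"
    unfolding ode using iP by (simp add: mult.assoc mult.commute)
  have radius: "fps_conv_radius (fps_deriv F) \<ge> min (fps_conv_radius P) (fps_conv_radius (inverse P))"
    unfolding F' fps_conv_radius_uminus
    by (intro order.trans[OF _ fps_conv_radius_mult] min.mono fps_conv_radius_deriv order.refl)
  \<comment> \<open>The quotient of two series of positive radius has positive radius.\<close>
  have Rpos: "R > 0"
  proof -
    have "fps_conv_radius P > 0" 
      using RP conv_radius_nonneg[of "fps_nth F"] unfolding R(1)[unfolded fps_conv_radius_def]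
      by (rule le_less_trans[rotated])
    moreover from this have "fps_conv_radius (inverse P) > 0"
      by (intro fps_conv_radius_inverse_pos) (simp_all add: P0)
    ultimately have "0 < fps_conv_radius (fps_deriv F)"
      using radius by (metis less_le_trans min_less_iff_conj)
    then show ?thesis using R by (simp add: zero_ereal_def)
  qed
  let ?P = "eval_fps P"
  have inP: "ereal x < fps_conv_radius P" if "x \<le> R" for x
    by (rule le_less_trans[OF _ RP]) (use that in simp)
  have cont: "continuous_on (cball 0 R) ?P"
    by (intro continuous_on_eval_fps') (auto simp: in_eball_iff inP continuous_on_id)
  have lower: "norm (?P (of_real (norm z))) \<le> norm (?P z)" if z: "z \<in> ball 0 R" for z
  proof -
    have zF: "ereal (norm w) < fps_conv_radius F" and zP: "ereal (norm w) < fps_conv_radius P"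
      if "norm w = norm z" for w :: complex
      using z by (simp_all add: R that inP)
    define t where "t = eval_fps F (of_real (norm z))"
    have P: "norm (?P w) = exp (- Re (eval_fps F w))" if "norm w = norm z" for w
    proof -
      have "?P w = exp (- eval_fps F w)"
        using fps_mult_exp_eq_1[OF P0 F0 ode zP[OF that] zF[OF that]]
        by (simp add: exp_minus field_simps)
      then show ?thesis by simp
    qed
    have "Re (eval_fps F z) \<le> norm (eval_fps F z)" by (rule complex_Re_le_cmod)
    also have "\<dots> \<le> Re t"
      unfolding t_def by (rule norm_eval_fps_le_eval_fps_norm[OF F f zF[OF refl]])
    finally show ?thesis
      using P[of z] P[of "of_real (norm z)"] by (simp add: t_def)
  qed
  have lower': "norm (?P (of_real (norm z))) \<le> norm (?P z)" if z: "z \<in> cball 0 R" for z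
  proof -
    have *: "continuous_on (cball 0 R) (\<lambda>z. norm (?P z) - norm (?P (of_real (norm z))))"
      by (intro continuous_intros cont continuous_on_compose2[OF cont]) auto
    have "0 \<le> norm (?P z) - norm (?P (of_real (norm z)))"
      by (rule continuous_ge_on_closure[of "ball 0 R" "\<lambda>z. norm (?P z) - norm (?P (of_real (norm z)))" z 0])
        (use * z lower Rpos in auto)
    then show ?thesis by simp
  qed
  have nz': "?P z \<noteq> 0" if z: "z \<in> cball 0 R" for z
  proof (cases "norm z = R")
    case True
    then show ?thesis using lower'[OF z] nz by auto
  next
    case False
    then have "ereal (norm z) < fps_conv_radius F" "ereal (norm z) < fps_conv_radius P"
      using z by (simp_all add: R inP)
    then show ?thesis using fps_mult_exp_eq_1[OF P0 F0 ode] by force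
  qed
  define U where "U = {z \<in> eball 0 (fps_conv_radius P). ?P z \<noteq> 0}"
  have "open U"
    unfolding U_def
    using continuous_open_preimage[OF continuous_on_eval_fps[of P] open_eball, of "- {0}"]
    by (simp add: vimage_def Int_def open_Compl)
  moreover have "cball 0 R \<subseteq> U"
    using nz' by (auto simp: U_def in_eball_iff inP)
  ultimately obtain e where e: "e > 0" "(\<Union>x\<in>cball 0 R. ball x e) \<subseteq> U"
    using compact_subset_open_imp_ball_epsilon_subset[of "cball 0 R" U] by auto
  have inU: "z \<in> U" if "norm z < R + e" for z :: complex
  proof (cases "norm z \<le> R")
    case True
    then show ?thesis using \<open>cball 0 R \<subseteq> U\<close> by auto
  next
    case False
    have "z \<noteq> 0" using False Rpos by auto
    \<comment> \<open>The point of the closed disc that is nearest to \<open>z\<close>.\<close>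
    define w where "w = of_real (R / norm z) * z"
    have "w \<in> cball 0 R" using \<open>z \<noteq> 0\<close> Rpos by (auto simp: w_def norm_mult norm_divide)
    moreover have "dist w z < e"
    proof -
      have "w - z = of_real (R / norm z - 1) * z" by (simp add: w_def algebra_simps)
      then have "norm (w - z) = \<bar>R / norm z - 1\<bar> * norm z" by (simp only: norm_mult norm_of_real)
      also have "\<dots> = norm z - R" using False Rpos \<open>z \<noteq> 0\<close> by (simp add: abs_if field_simps)
      finally show ?thesis using that by (simp add: dist_norm)
    qed
    ultimately show ?thesis using e(2) by (meson UN_I mem_ball subsetD)
  qed
  \<comment> \<open>The inner minimum restricts the hypothesis to points where \<open>eval_fps P\<close> is the sum of a convergent series.\<close>
  have "fps_conv_radius (inverse P) \<ge> min (min (ereal (R + e)) (fps_conv_radius P)) (fps_conv_radius P)"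
  proof (rule fps_conv_radius_inverse)
    fix z :: complex assume "ereal (norm z) < min (ereal (R + e)) (fps_conv_radius P)"
    then show "eval_fps P z \<noteq> 0" using inU[of z] by (auto simp: U_def)
  qed
  then have "min (ereal (R + e)) (fps_conv_radius P) \<le> min (fps_conv_radius P) (fps_conv_radius (inverse P))"
    by (simp add: min.assoc)
  also note radius
  also note R(2)
  finally show False using e(1) RP by (auto simp: min_def split: if_splits)
qed

section \<open>Rotation classes and maximal prefixes of lists\<close>

definition cycle_class :: "'b list \<Rightarrow> 'b list set" where
  "cycle_class q = range (\<lambda>k. rotate k q)"

lemma self_in_cycle_class: "q \<in> cycle_class q"
  unfolding cycle_class_def by (rule range_eqI[of _ _ 0]) simp

lemma cycle_class_append: "cycle_class (y @ x) = cycle_class (x @ y)"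
proof -
  have sub: "cycle_class (v @ u) \<subseteq> cycle_class (u @ v)" for u v :: "'b list"
  proof
    fix p assume "p \<in> cycle_class (v @ u)"
    then obtain k where "p = rotate k (rotate (length u) (u @ v))"
      by (auto simp: cycle_class_def rotate_append)
    then show "p \<in> cycle_class (u @ v)" by (simp add: cycle_class_def rotate_rotate)
  qed
  show ?thesis using sub[of x y] sub[of y x] by blast
qed

lemma mem_cycle_classE:
  assumes "p \<in> cycle_class q"
  obtains x y where "q = x @ y" "p = y @ x"
proof -
  from assms obtain k where "p = rotate k q" by (auto simp: cycle_class_def)
  then show ?thesis
    using that[of "take (k mod length q) q" "drop (k mod length q) q"]
    by (simp add: rotate_drop_take)
qed

lemma cycle_class_eq: "p \<in> cycle_class q \<Longrightarrow> cycle_class p = cycle_class q"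
  by (metis mem_cycle_classE cycle_class_append)

lemma cycle_length_class: "cycle_length (cycle_class q) = length q"
  unfolding cycle_class_def by (rule cycle_length_rotations)

lemma cycle_support_class: "cycle_support G (cycle_class q) = tail G ` set q"
  unfolding cycle_class_def by (rule cycle_support_rotations)

lemma finite_cycle_class: "finite (cycle_class q)"
proof -
  have "cycle_class q \<subseteq> (\<lambda>n. rotate n q) ` {..length q}"
  proof
    fix p assume "p \<in> cycle_class q"
    then obtain x y where "q = x @ y" "p = y @ x" by (rule mem_cycle_classE)
    then show "p \<in> (\<lambda>n. rotate n q) ` {..length q}"
      by (auto intro!: image_eqI[of _ _ "length x"] simp: rotate_append)
  qed
  then show ?thesis by (rule finite_subset) simp
qed

lemma card_cycle_class:
  assumes "distinct q" "q \<noteq> []"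
  shows "card (cycle_class q) = length q"
proof -
  have "rotate k q \<in> (\<lambda>n. rotate n q) ` {..<length q}" for k
    using assms(2) by (intro image_eqI[of _ _ "k mod length q"]) (simp_all add: rotate_conv_mod[symmetric])
  then have "cycle_class q = (\<lambda>n. rotate n q) ` {..<length q}"
    unfolding cycle_class_def by blast
  moreover have "inj_on (\<lambda>n. rotate n q) {..<length q}"
  proof (rule inj_onI)
    fix m n assume "m \<in> {..<length q}" "n \<in> {..<length q}" "rotate m q = rotate n q"
    then have "q ! m = q ! n"
      using hd_rotate_conv_nth[OF assms(2), of m] hd_rotate_conv_nth[OF assms(2), of n] by simp
    then show "m = n" using assms \<open>m \<in> _\<close> \<open>n \<in> _\<close> by (simp add: nth_eq_iff_index_eq)
  qed
  ultimately show ?thesis by (simp add: card_image)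
qed

text \<open>
  The stopping rule of the cancellation. With \<open>f\<close> the source of an edge and \<open>U\<close> the support of a
  multi-cycle, \<open>a\<close> is the part of the path before the first visited vertex that lies in \<open>U\<close> or has
  been visited before. The prefix is determined by the path and by \<open>U\<close>, as the next lemma shows;
  the injectivity of the maps below rests on this.
\<close>

lemma ex_maximal_prefix:
  "\<exists>a b. p = a @ b \<and> distinct (map f a) \<and> f ` set a \<inter> U = {} \<and>
     (b = [] \<or> f (hd b) \<in> U \<or> f (hd b) \<in> f ` set a)"
proof (induction p rule: rev_induct)
  case Nil
  then show ?case by auto
next
  case (snoc e p)
  then obtain a b where ab: "p = a @ b" "distinct (map f a)" "f ` set a \<inter> U = {}"
    "b = [] \<or> f (hd b) \<in> U \<or> f (hd b) \<in> f ` set a" by blast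
  show ?case
  proof (cases "b = [] \<and> f e \<notin> U \<and> f e \<notin> f ` set a")
    case True
    then show ?thesis using ab by (intro exI[of _ "a @ [e]"] exI[of _ "[]"]) auto
  next
    case False
    then show ?thesis using ab by (intro exI[of _ a] exI[of _ "b @ [e]"]) (cases b; auto)
  qed
qed

lemma maximal_prefix_unique:
  assumes "a @ b = a' @ b'"
    and "distinct (map f a)" "f ` set a \<inter> U = {}" "b = [] \<or> f (hd b) \<in> U \<or> f (hd b) \<in> f ` set a"
    and "distinct (map f a')" "f ` set a' \<inter> U = {}" "b' = [] \<or> f (hd b') \<in> U \<or> f (hd b') \<in> f ` set a'"
  shows "a = a' \<and> b = b'"
proof -
  have False if eq: "x @ y = x' @ y'" and less: "length x < length x'"
    and "y = [] \<or> f (hd y) \<in> U \<or> f (hd y) \<in> f ` set x"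
    and "distinct (map f x')" and "f ` set x' \<inter> U = {}" for x y x' y'
  proof -
    obtain us where us: "x' = x @ us" "us @ y' = y" "us \<noteq> []"
      using eq less by (auto simp: append_eq_append_conv2)
    then obtain e es where "us = e # es" by (cases us) auto
    then show False using that us by auto
  qed
  from this[of a b a' b'] this[of a' b' a b] assms have "length a = length a'"
    by (metis nat_neq_iff)
  then show ?thesis using assms(1) by simp
qed


context wf_digraph
begin


section \<open>Closed walks, simple cycles and multi-cycles\<close>

text \<open>
  The closed paths of positive length, without reference to the length.
\<close>

definition closed_walk :: "'b list \<Rightarrow> bool" where
  "closed_walk p \<longleftrightarrow> p \<noteq> [] \<and> (\<exists>v. awalk v p v)"

definition support :: "'b list set set \<Rightarrow> 'a set" where
  "support \<gamma> = (\<Union>c\<in>\<gamma>. cycle_support G c)"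

lemma mem_closed_paths_iff: "p \<in> closed_paths G n \<longleftrightarrow> closed_walk p \<and> length p = n"
  by (auto simp: closed_paths_def closed_walk_def)

lemma cycle_iff: "cycle q \<longleftrightarrow> closed_walk q \<and> distinct (map (tail G) q)"
  unfolding cycle_iff_distinct_sources by (simp add: mem_closed_paths_iff)

lemma awalk_appendE:
  assumes "awalk u (p @ q) v"
  obtains w where "awalk u p w" "awalk w q v"
  using assms by auto

lemma awalk_append: "awalk u p w \<Longrightarrow> awalk w q v \<Longrightarrow> awalk u (p @ q) v"
  by (rule awalk_appendI) auto

lemma awalk_tail_hd: "awalk u p v \<Longrightarrow> p \<noteq> [] \<Longrightarrow> tail G (hd p) = u"
  by (cases p) (auto simp: awalk_Cons_iff)

lemma closed_walk_rotate:
  assumes "closed_walk (x @ y)"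
  shows "closed_walk (y @ x)"
proof -
  from assms obtain v where "awalk v (x @ y) v" by (auto simp: closed_walk_def)
  then obtain w where "awalk v x w" "awalk w y v" by (rule awalk_appendE)
  then have "awalk w (y @ x) w" by (intro awalk_append)
  then show ?thesis using assms by (auto simp: closed_walk_def simp del: awalk_append_iff)
qed

lemma closed_walk_splice:
  assumes "closed_walk (a @ b)" "b \<noteq> []" "closed_walk q" "tail G (hd q) = tail G (hd b)"
  shows "closed_walk (a @ q @ b)"
proof -
  from assms(1) obtain v where "awalk v (a @ b) v" by (auto simp: closed_walk_def)
  then obtain w where w: "awalk v a w" "awalk w b v" by (rule awalk_appendE)
  from assms(3) obtain u where u: "awalk u q u" "q \<noteq> []" by (auto simp: closed_walk_def)
  have "u = w" using awalk_tail_hd[OF u] awalk_tail_hd[OF w(2) assms(2)] assms(4) by simp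
  then have "awalk v (a @ q @ b) v"
    using w u by (intro awalk_append[OF w(1)] awalk_append[of w q w]) simp_all
  then show ?thesis using u by (auto simp: closed_walk_def simp del: awalk_append_iff)
qed

lemma closed_walk_unsplice:
  assumes "closed_walk (a @ q @ b)" "q \<noteq> []" "b \<noteq> []" "tail G (hd q) = tail G (hd b)"
  shows "closed_walk q" "closed_walk (a @ b)"
proof -
  from assms(1) obtain v where "awalk v (a @ q @ b) v" by (auto simp: closed_walk_def)
  then obtain w where w: "awalk v a w" "awalk w (q @ b) v" by (rule awalk_appendE)
  from w(2) obtain x where x: "awalk w q x" "awalk x b v" by (rule awalk_appendE)
  have "w = x" using awalk_tail_hd[OF x(1) assms(2)] awalk_tail_hd[OF x(2) assms(3)] assms(4) by simp
  then show "closed_walk q" "closed_walk (a @ b)"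
    using w x assms awalk_append[OF w(1), of b v] by (auto simp: closed_walk_def)
qed

lemma cycle_rotate: "cycle (x @ y) \<Longrightarrow> cycle (y @ x)"
  by (auto simp: cycle_iff dest: closed_walk_rotate)

lemma cycle_of_class:
  assumes "cycle q" "p \<in> cycle_class q"
  shows "cycle p"
  using assms(2) by (rule mem_cycle_classE) (use assms(1) cycle_rotate in blast)

lemma simple_cycles_eq: "simple_cycles G = cycle_class ` Collect cycle"
  by (auto simp: simple_cycles_def cycle_class_def)

lemma cycle_class_mem_simple_cycles: "cycle q \<Longrightarrow> cycle_class q \<in> simple_cycles G"
  by (auto simp: simple_cycles_eq)

lemma simple_cycle_based_at:
  assumes "c \<in> simple_cycles G" "w \<in> cycle_support G c"
  obtains q where "cycle q" "c = cycle_class q" "tail G (hd q) = w"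
proof -
  from assms(1) obtain p where p: "cycle p" "c = cycle_class p" by (auto simp: simple_cycles_eq)
  with assms(2) obtain e where e: "e \<in> set p" "tail G e = w" by (auto simp: cycle_support_class)
  then obtain x y where xy: "p = x @ e # y" by (auto dest: split_list)
  show ?thesis
  proof
    show "cycle ((e # y) @ x)" by (rule cycle_rotate) (use p xy in simp)
    show "c = cycle_class ((e # y) @ x)" using p xy by (simp only: cycle_class_append)
    show "tail G (hd ((e # y) @ x)) = w" using e by simp
  qed
qed

text \<open>
  A simple cycle visits each of its vertices once, so a vertex singles out one rotation.
\<close>

lemma based_representative_unique:
  assumes "cycle q" "cycle q'" "cycle_class q = cycle_class q'" "tail G (hd q) = tail G (hd q')"
  shows "q = q'"
proof -
  have "q \<in> cycle_class q'" using assms(3) self_in_cycle_class[of q] by simp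
  then obtain x y where xy: "q' = x @ y" "q = y @ x" by (rule mem_cycle_classE)
  have "distinct (map (tail G) (x @ y))" using assms(2) xy by (simp add: cycle_iff)
  then show ?thesis using xy assms(4) by (cases x; cases y) auto
qed

lemma insert_multi_cycle:
  assumes "\<gamma> \<in> multi_cycles G" "cycle q" "tail G ` set q \<inter> support \<gamma> = {}"
  shows "cycle_class q \<notin> \<gamma>"
    and "insert (cycle_class q) \<gamma> \<in> multi_cycles G"
    and "multi_cycle_length (insert (cycle_class q) \<gamma>) = length q + multi_cycle_length \<gamma>"
    and "card (insert (cycle_class q) \<gamma>) = Suc (card \<gamma>)"
proof -
  have fin: "finite \<gamma>" using assms(1) by (simp add: multi_cycles_def)
  show notin: "cycle_class q \<notin> \<gamma>"
  proof
    assume "cycle_class q \<in> \<gamma>"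
    then have "tail G ` set q \<subseteq> support \<gamma>" by (auto simp: support_def cycle_support_class)
    then have "tail G ` set q = {}" using assms(3) by (simp add: Int_absorb2)
    then show False using assms(2) by (simp add: cycle_iff closed_walk_def)
  qed
  show "multi_cycle_length (insert (cycle_class q) \<gamma>) = length q + multi_cycle_length \<gamma>"
    using fin notin by (simp add: multi_cycle_length_def cycle_length_class)
  show "card (insert (cycle_class q) \<gamma>) = Suc (card \<gamma>)" using fin notin by simp
  have "tail G ` set q \<inter> cycle_support G c = {}" if "c \<in> \<gamma>" for c
    using assms(3) that by (auto simp: support_def)
  then show "insert (cycle_class q) \<gamma> \<in> multi_cycles G"
    using assms(1,2) notin
    by (simp add: multi_cycles_def disjoint_family_on_insert cycle_class_mem_simple_cycles
        cycle_support_class)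
      (auto simp: support_def)
qed

lemma remove_multi_cycle:
  assumes "\<delta> \<in> multi_cycles G" "c \<in> \<delta>"
  shows "\<delta> - {c} \<in> multi_cycles G" "cycle_support G c \<inter> support (\<delta> - {c}) = {}"
    "support (\<delta> - {c}) \<subseteq> support \<delta>"
proof -
  show "\<delta> - {c} \<in> multi_cycles G"
    using assms by (auto simp: multi_cycles_def disjoint_family_on_def)
  have "cycle_support G c \<inter> cycle_support G d = {}" if "d \<in> \<delta> - {c}" for d
    using assms that unfolding multi_cycles_def disjoint_family_on_def by fastforce
  then show "cycle_support G c \<inter> support (\<delta> - {c}) = {}" by (auto simp: support_def)
  show "support (\<delta> - {c}) \<subseteq> support \<delta>" by (auto simp: support_def)
qed


section \<open>Cancellation between multi-cycles and closed paths\<close>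

definition multi_cycles_of_length :: "nat \<Rightarrow> 'b list set set set" where
  "multi_cycles_of_length n = {\<gamma> \<in> multi_cycles G. multi_cycle_length \<gamma> = n}"

definition multi_cycle_coeff :: "nat \<Rightarrow> complex" where
  "multi_cycle_coeff n = (\<Sum>\<gamma>\<in>multi_cycles_of_length n. (- 1) ^ card \<gamma>)"

text \<open>
  The index set of the left-hand side of Newton's identity. It splits into three parts according
  to what stops the walk along \<open>p\<close> first: the support of \<open>\<gamma>\<close>, a vertex of \<open>p\<close> itself, or only the
  end of \<open>p\<close>.
\<close>

definition decorated :: "nat \<Rightarrow> ('b list set set \<times> 'b list) set" where
  "decorated n = {(\<gamma>, p). \<gamma> \<in> multi_cycles G \<and> closed_walk p \<and> multi_cycle_length \<gamma> + length p = n}"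

definition enters_support :: "'b list set set \<times> 'b list \<Rightarrow> bool" where
  "enters_support = (\<lambda>(\<gamma>, p). \<exists>a b. p = a @ b \<and> b \<noteq> [] \<and> distinct (map (tail G) a) \<and>
     tail G ` set a \<inter> support \<gamma> = {} \<and> tail G (hd b) \<in> support \<gamma>)"

definition closes_loop :: "'b list set set \<times> 'b list \<Rightarrow> bool" where
  "closes_loop = (\<lambda>(\<gamma>, p). \<exists>a b. p = a @ b \<and> b \<noteq> [] \<and> distinct (map (tail G) a) \<and>
     tail G ` set a \<inter> support \<gamma> = {} \<and> tail G (hd b) \<in> tail G ` set a)"

definition detached_cycle :: "'b list set set \<times> 'b list \<Rightarrow> bool" where
  "detached_cycle = (\<lambda>(\<gamma>, p). distinct (map (tail G) p) \<and> tail G ` set p \<inter> support \<gamma> = {})"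

text \<open>
  The common parameter space of the two parts that cancel: a closed path \<open>a @ b\<close> and a simple cycle
  \<open>q\<close> through the vertex between \<open>a\<close> and \<open>b\<close>. The cycle can be counted either as a component
  of the multi-cycle or as a detour of the path. Requiring \<open>b \<noteq> []\<close> loses nothing in the first case,
  where an empty \<open>b\<close> would put the base point into the support although \<open>a\<close> avoids it; in the second
  case it excludes exactly the paths that are a single simple cycle.
\<close>

definition spliced :: "nat \<Rightarrow> ('b list set set \<times> 'b list \<times> 'b list \<times> 'b list) set" where
  "spliced n = {(\<gamma>, a, q, b). \<gamma> \<in> multi_cycles G \<and> cycle q \<and> b \<noteq> [] \<and> tail G (hd b) = tail G (hd q) \<and>
     closed_walk (a @ b) \<and> distinct (map (tail G) (a @ q)) \<and> tail G ` set (a @ q) \<inter> support \<gamma> = {} \<and>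
     multi_cycle_length \<gamma> + length (a @ q @ b) = n}"

lemma support_insert: "support (insert (cycle_class q) \<gamma>) = tail G ` set q \<union> support \<gamma>"
  by (simp add: support_def cycle_support_class)

lemma cycle_nonempty: "cycle q \<Longrightarrow> q \<noteq> []"
  by (simp add: cycle_iff closed_walk_def)

text \<open>
  Cutting a closed path at a vertex that it repeats leaves a shorter closed path with the same base
  point, and iterating this ends with a simple cycle. This is what bounds the set of possible base points of closed paths of a given length.
\<close>

lemma simple_cycle_through:
  assumes "closed_walk p"
  shows "\<exists>q. cycle q \<and> tail G (hd q) = tail G (hd p) \<and> length q \<le> length p"
  using assms
proof (induction "length p" arbitrary: p rule: less_induct)
  case less
  obtain a b where ab: "p = a @ b" "distinct (map (tail G) a)"
    "b = [] \<or> tail G (hd b) \<in> tail G ` set a"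
    using ex_maximal_prefix[of p "tail G" "{}"] by auto
  show ?case
  proof (cases "b = []")
    case True
    then show ?thesis using ab less.prems by (auto simp: cycle_iff)
  next
    case False
    then obtain e where e: "e \<in> set a" "tail G e = tail G (hd b)" using ab by auto
    then obtain x y where xy: "a = x @ e # y" by (auto dest: split_list)
    have closed: "closed_walk (x @ (e # y) @ b)" using less.prems ab xy by simp
    have "tail G (hd (e # y)) = tail G (hd b)" using e by simp
    note * = closed_walk_unsplice[OF closed _ False this]
    show ?thesis
    proof (cases "x = []")
      case True
      have "length (e # y) < length p" using ab xy False True by simp
      from less.hyps[OF this *(1)] obtain q where
        "cycle q" "tail G (hd q) = tail G e" "length q \<le> length (e # y)" by auto
      then show ?thesis using ab xy True by (intro exI[of _ q]) auto
    next
      case False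
      have "length (x @ b) < length p" using ab xy by simp
      from less.hyps[OF this *(2)] obtain q where
        "cycle q" "tail G (hd q) = tail G (hd (x @ b))" "length q \<le> length (x @ b)" by auto
      then show ?thesis using ab xy False by (intro exI[of _ q]) auto
    qed
  qed
qed

text \<open>
  Counting \<open>q\<close> as a component. To recover the quadruple, \<open>a\<close> is the maximal prefix outside the
  support, and \<open>q\<close> is the component that contains the next vertex, started at that vertex.
\<close>

lemma bij_betw_spliced_enters_support:
  "bij_betw (\<lambda>(\<gamma>, a, q, b). (insert (cycle_class q) \<gamma>, a @ b)) (spliced n) {x \<in> decorated n. enters_support x}"
proof (rule bij_betwI')
  fix s t assume s: "s \<in> spliced n" and t: "t \<in> spliced n"
  obtain \<gamma> a q b where s_eq: "s = (\<gamma>, a, q, b)" by (cases s)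
  obtain \<gamma>' a' q' b' where t_eq: "t = (\<gamma>', a', q', b')" by (cases t)
  show "((case s of (\<gamma>, a, q, b) \<Rightarrow> (insert (cycle_class q) \<gamma>, a @ b)) =
      (case t of (\<gamma>, a, q, b) \<Rightarrow> (insert (cycle_class q) \<gamma>, a @ b))) = (s = t)"
  proof
    assume "(case s of (\<gamma>, a, q, b) \<Rightarrow> (insert (cycle_class q) \<gamma>, a @ b)) =
      (case t of (\<gamma>, a, q, b) \<Rightarrow> (insert (cycle_class q) \<gamma>, a @ b))"
    then have eq: "insert (cycle_class q) \<gamma> = insert (cycle_class q') \<gamma>'" "a @ b = a' @ b'"
      by (simp_all add: s_eq t_eq)
    have q: "cycle q" "cycle q'" "tail G (hd b) = tail G (hd q)" "tail G (hd b') = tail G (hd q')"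
      and \<gamma>: "\<gamma> \<in> multi_cycles G" "\<gamma>' \<in> multi_cycles G"
      and d: "tail G ` set q \<inter> support \<gamma> = {}" "tail G ` set q' \<inter> support \<gamma>' = {}"
      using s t by (auto simp: s_eq t_eq spliced_def)
    have hd_q: "tail G (hd q) \<in> tail G ` set q" "tail G (hd q') \<in> tail G ` set q'"
      using q(1,2) by (auto dest!: cycle_nonempty)
    let ?U = "support (insert (cycle_class q) \<gamma>)"
    have "a = a' \<and> b = b'"
    proof (rule maximal_prefix_unique[OF eq(2), where f = "tail G" and U = ?U])
      show "distinct (map (tail G) a)" "distinct (map (tail G) a')"
        using s t by (auto simp: s_eq t_eq spliced_def)
      show "tail G ` set a \<inter> ?U = {}"
        using s unfolding support_insert by (auto simp: s_eq spliced_def)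
      show "tail G ` set a' \<inter> ?U = {}"
        using t unfolding eq(1) support_insert by (auto simp: t_eq spliced_def)
      show "b = [] \<or> tail G (hd b) \<in> ?U \<or> tail G (hd b) \<in> tail G ` set a"
        using q(3) hd_q(1) unfolding support_insert by simp
      show "b' = [] \<or> tail G (hd b') \<in> ?U \<or> tail G (hd b') \<in> tail G ` set a'"
        using q(4) hd_q(2) unfolding eq(1) support_insert by simp
    qed
    then have ab: "a = a'" "b = b'" by auto
    \<comment> \<open>The inserted cycle is the component of the multi-cycle through the point of entry.\<close>
    have "cycle_class q = cycle_class q'"
    proof (rule ccontr)
      assume ne: "cycle_class q \<noteq> cycle_class q'"
      then have "cycle_class q \<in> \<gamma>'" using eq(1) by auto
      then have "tail G ` set q \<subseteq> support \<gamma>'" by (auto simp: support_def cycle_support_class)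
      moreover have "tail G (hd q) \<in> tail G ` set q'" using q ab hd_q(2) by simp
      ultimately show False using d(2) hd_q(1) by auto
    qed
    moreover from this have "q = q'" using q ab by (intro based_representative_unique) auto
    moreover have "\<gamma> = \<gamma>'"
      using eq(1) insert_multi_cycle(1)[OF \<gamma>(1) q(1) d(1)] insert_multi_cycle(1)[OF \<gamma>(2) q(2) d(2)]
        \<open>q = q'\<close> by (simp add: insert_ident)
    ultimately show "s = t" using ab by (simp add: s_eq t_eq)
  qed simp
next
  fix s assume s: "s \<in> spliced n"
  obtain \<gamma> a q b where s_eq: "s = (\<gamma>, a, q, b)" by (cases s)
  have *: "\<gamma> \<in> multi_cycles G" "cycle q" "tail G ` set q \<inter> support \<gamma> = {}"
    using s by (auto simp: s_eq spliced_def)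
  have "tail G (hd q) \<in> tail G ` set q" using cycle_nonempty[OF *(2)] by auto
  then have "enters_support (insert (cycle_class q) \<gamma>, a @ b)"
    using s unfolding enters_support_def prod.case support_insert
    by (intro exI[of _ a] exI[of _ b]) (auto simp: s_eq spliced_def)
  moreover have "(insert (cycle_class q) \<gamma>, a @ b) \<in> decorated n"
    using s insert_multi_cycle[OF *] by (auto simp: s_eq spliced_def decorated_def)
  ultimately show "(case s of (\<gamma>, a, q, b) \<Rightarrow> (insert (cycle_class q) \<gamma>, a @ b)) \<in> {x \<in> decorated n. enters_support x}"
    by (simp add: s_eq)
next
  fix x assume x: "x \<in> {x \<in> decorated n. enters_support x}"
  obtain \<delta> p where x_eq: "x = (\<delta>, p)" by (cases x)
  from x obtain a b where ab: "p = a @ b" "b \<noteq> []" "distinct (map (tail G) a)"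
    "tail G ` set a \<inter> support \<delta> = {}" "tail G (hd b) \<in> support \<delta>"
    by (auto simp: x_eq enters_support_def)
  have \<delta>: "\<delta> \<in> multi_cycles G" "closed_walk (a @ b)" "multi_cycle_length \<delta> + length (a @ b) = n"
    using x ab by (auto simp: x_eq decorated_def)
  from ab(5) obtain c where c: "c \<in> \<delta>" "tail G (hd b) \<in> cycle_support G c"
    by (auto simp: support_def)
  then have "c \<in> simple_cycles G" using \<delta>(1) by (auto simp: multi_cycles_def)
  then obtain q where q: "cycle q" "c = cycle_class q" "tail G (hd q) = tail G (hd b)"
    using simple_cycle_based_at c(2) by blast
  have rem: "\<delta> - {c} \<in> multi_cycles G" "tail G ` set q \<inter> support (\<delta> - {c}) = {}"
    "support (\<delta> - {c}) \<subseteq> support \<delta>"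
    using remove_multi_cycle[OF \<delta>(1) c(1)] by (simp_all add: q(2) cycle_support_class)
  have ins: "insert (cycle_class q) (\<delta> - {c}) = \<delta>" using c(1) q(2) by auto
  have "tail G ` set q \<subseteq> support \<delta>" using c(1) q(2) by (auto simp: support_def cycle_support_class)
  then have disj: "tail G ` set a \<inter> tail G ` set q = {}" using ab(4) by auto
  have "distinct (map (tail G) (a @ q))" using q(1) ab(3) disj by (simp add: cycle_iff)
  moreover have "tail G ` set (a @ q) \<inter> support (\<delta> - {c}) = {}" using ab(4) rem(2,3) by auto
  moreover have "multi_cycle_length (\<delta> - {c}) + length (a @ q @ b) = n"
    using insert_multi_cycle(3)[OF rem(1) q(1) rem(2)] \<delta>(3) unfolding ins by simp
  ultimately have "(\<delta> - {c}, a, q, b) \<in> spliced n"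
    unfolding spliced_def using rem(1) q(1,3) \<delta>(2) ab(2) by simp
  then show "\<exists>s\<in>spliced n. x = (case s of (\<gamma>, a, q, b) \<Rightarrow> (insert (cycle_class q) \<gamma>, a @ b))"
    using ins ab(1) by (intro bexI[of _ "(\<delta> - {c}, a, q, b)"]) (simp_all add: x_eq)
qed

text \<open>
  Counting \<open>q\<close> as a detour. To recover the quadruple, \<open>a @ q\<close> is the maximal prefix with distinct
  vertices, and \<open>q\<close> starts where that prefix first visits the vertex to which it returns.
\<close>

lemma bij_betw_spliced_closes_loop:
  "bij_betw (\<lambda>(\<gamma>, a, q, b). (\<gamma>, a @ q @ b)) (spliced n) {x \<in> decorated n. closes_loop x}"
proof (rule bij_betwI')
  fix s t assume s: "s \<in> spliced n" and t: "t \<in> spliced n"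
  obtain \<gamma> a q b where s_eq: "s = (\<gamma>, a, q, b)" by (cases s)
  obtain \<gamma>' a' q' b' where t_eq: "t = (\<gamma>', a', q', b')" by (cases t)
  show "((case s of (\<gamma>, a, q, b) \<Rightarrow> (\<gamma>, a @ q @ b)) =
      (case t of (\<gamma>, a, q, b) \<Rightarrow> (\<gamma>, a @ q @ b))) = (s = t)"
  proof
    assume "(case s of (\<gamma>, a, q, b) \<Rightarrow> (\<gamma>, a @ q @ b)) = (case t of (\<gamma>, a, q, b) \<Rightarrow> (\<gamma>, a @ q @ b))"
    then have eq: "\<gamma> = \<gamma>'" "(a @ q) @ b = (a' @ q') @ b'" by (simp_all add: s_eq t_eq)
    have q: "cycle q" "cycle q'" "tail G (hd b) = tail G (hd q)" "tail G (hd b') = tail G (hd q')"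
      and dist: "distinct (map (tail G) (a @ q))" "distinct (map (tail G) (a' @ q'))"
      and disj: "tail G ` set (a @ q) \<inter> support \<gamma> = {}" "tail G ` set (a' @ q') \<inter> support \<gamma> = {}"
      using s t eq(1) by (auto simp: s_eq t_eq spliced_def)
    have ne: "q \<noteq> []" "q' \<noteq> []" using q by (auto dest: cycle_nonempty)
    have "a @ q = a' @ q' \<and> b = b'"
      by (rule maximal_prefix_unique[OF eq(2), where f = "tail G" and U = "support \<gamma>"])
        (use dist disj q ne in auto)
    then have b: "a @ q = a' @ q'" "b = b'" by auto
    \<comment> \<open>Splitting off \<open>q\<close> is determined by the base point, which occurs only once.\<close>
    have "a = a' \<and> q = q'"
    proof (rule maximal_prefix_unique[OF b(1), where f = "tail G" and U = "{tail G (hd b)}"])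
      show "distinct (map (tail G) a)" "distinct (map (tail G) a')" using dist by auto
      show "q = [] \<or> tail G (hd q) \<in> {tail G (hd b)} \<or> tail G (hd q) \<in> tail G ` set a"
        "q' = [] \<or> tail G (hd q') \<in> {tail G (hd b)} \<or> tail G (hd q') \<in> tail G ` set a'"
        using q b by auto
      have "tail G (hd q) \<notin> tail G ` set a" "tail G (hd q') \<notin> tail G ` set a'"
        using dist ne hd_in_set[of q] hd_in_set[of q'] by (auto simp del: hd_in_set)
      then show "tail G ` set a \<inter> {tail G (hd b)} = {}" "tail G ` set a' \<inter> {tail G (hd b)} = {}"
        using q b by simp_all
    qed
    then show "s = t" using eq b by (simp add: s_eq t_eq)
  qed simp
next
  fix s assume s: "s \<in> spliced n"
  obtain \<gamma> a q b where s_eq: "s = (\<gamma>, a, q, b)" by (cases s)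
  have *: "\<gamma> \<in> multi_cycles G" "cycle q" "closed_walk (a @ b)" "b \<noteq> []"
    "tail G (hd q) = tail G (hd b)" "multi_cycle_length \<gamma> + length (a @ q @ b) = n"
    using s by (auto simp: s_eq spliced_def)
  have "tail G (hd q) \<in> tail G ` set q" using cycle_nonempty[OF *(2)] by auto
  then have "closes_loop (\<gamma>, a @ q @ b)"
    using s unfolding closes_loop_def prod.case
    by (intro exI[of _ "a @ q"] exI[of _ b]) (auto simp: s_eq spliced_def)
  moreover have "closed_walk (a @ q @ b)"
    using * by (intro closed_walk_splice) (auto simp: cycle_iff)
  ultimately show "(case s of (\<gamma>, a, q, b) \<Rightarrow> (\<gamma>, a @ q @ b)) \<in> {x \<in> decorated n. closes_loop x}"
    using * by (simp add: s_eq decorated_def)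
next
  fix x assume x: "x \<in> {x \<in> decorated n. closes_loop x}"
  obtain \<gamma> p where x_eq: "x = (\<gamma>, p)" by (cases x)
  from x obtain a' b where ab: "p = a' @ b" "b \<noteq> []" "distinct (map (tail G) a')"
    "tail G ` set a' \<inter> support \<gamma> = {}" "tail G (hd b) \<in> tail G ` set a'"
    by (auto simp: x_eq closes_loop_def)
  from ab(5) obtain e where e: "e \<in> set a'" "tail G e = tail G (hd b)" by auto
  then obtain a y where ay: "a' = a @ e # y" by (auto dest: split_list)
  define q where "q = e # y"
  have \<gamma>: "\<gamma> \<in> multi_cycles G" "closed_walk (a @ q @ b)" "multi_cycle_length \<gamma> + length (a @ q @ b) = n"
    using x ab(1) ay by (auto simp: x_eq decorated_def q_def)
  have q: "q \<noteq> []" "tail G (hd q) = tail G (hd b)" "a' = a @ q" using e ay by (auto simp: q_def)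
  note u = closed_walk_unsplice[OF \<gamma>(2) q(1) ab(2) q(2)]
  have "cycle q" using u(1) ab(3) q(3) by (simp add: cycle_iff)
  then have "(\<gamma>, a, q, b) \<in> spliced n"
    unfolding spliced_def using u(2) \<gamma> q ab by simp
  then show "\<exists>s\<in>spliced n. x = (case s of (\<gamma>, a, q, b) \<Rightarrow> (\<gamma>, a @ q @ b))"
    using ab(1) q(3) by (intro bexI[of _ "(\<gamma>, a, q, b)"]) (simp_all add: x_eq)
qed


lemma decorated_cases:
  assumes "x \<in> decorated n"
  shows "enters_support x \<or> closes_loop x \<or> detached_cycle x"
proof -
  obtain \<gamma> p where x: "x = (\<gamma>, p)" by (cases x)
  obtain a b where ab: "p = a @ b" "distinct (map (tail G) a)" "tail G ` set a \<inter> support \<gamma> = {}"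
    "b = [] \<or> tail G (hd b) \<in> support \<gamma> \<or> tail G (hd b) \<in> tail G ` set a"
    using ex_maximal_prefix[of p "tail G" "support \<gamma>"] by blast
  show ?thesis
  proof (cases "b = []")
    case True
    then show ?thesis using ab by (simp add: x detached_cycle_def)
  next
    case False
    then have "enters_support x \<or> closes_loop x"
      using ab unfolding x enters_support_def closes_loop_def prod.case by blast
    then show ?thesis by blast
  qed
qed

lemma decorated_cases_disjoint:
  "\<not> (enters_support x \<and> closes_loop x)" "\<not> (enters_support x \<and> detached_cycle x)"
  "\<not> (closes_loop x \<and> detached_cycle x)"
proof -
  obtain \<gamma> p where x: "x = (\<gamma>, p)" by (cases x)
  note defs = x enters_support_def closes_loop_def detached_cycle_def prod.case
  note uniq = maximal_prefix_unique[where f = "tail G" and U = "support \<gamma>"]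
  show "\<not> (enters_support x \<and> closes_loop x)"
  proof
    assume "enters_support x \<and> closes_loop x"
    then obtain a b a' b' where "p = a @ b" "b \<noteq> []" "distinct (map (tail G) a)"
      "tail G ` set a \<inter> support \<gamma> = {}" "tail G (hd b) \<in> support \<gamma>"
      and "p = a' @ b'" "b' \<noteq> []" "distinct (map (tail G) a')"
      "tail G ` set a' \<inter> support \<gamma> = {}" "tail G (hd b') \<in> tail G ` set a'"
      unfolding defs by blast
    moreover from this have "a = a' \<and> b = b'" by (intro uniq) simp_all
    ultimately show False by auto
  qed
  show "\<not> (enters_support x \<and> detached_cycle x)"
  proof
    assume "enters_support x \<and> detached_cycle x"
    then obtain a b where "p = a @ b" "b \<noteq> []" "tail G (hd b) \<in> support \<gamma>"
      "tail G ` set p \<inter> support \<gamma> = {}"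
      unfolding defs by blast
    then show False by (cases b) auto
  qed
  show "\<not> (closes_loop x \<and> detached_cycle x)"
  proof
    assume "closes_loop x \<and> detached_cycle x"
    then obtain a b where "p = a @ b" "b \<noteq> []" "tail G (hd b) \<in> tail G ` set a"
      "distinct (map (tail G) p)"
      unfolding defs by blast
    then show False by (cases b) auto
  qed
qed

text \<open>
  A pair that does not cancel consists of a multi-cycle and a further component with a base point.
  Since a representative of a rotation class amounts to a base point, the pair is the same as a
  multi-cycle \<open>\<delta>\<close> together with an element of \<open>\<Union> \<delta>\<close>.
\<close>

lemma bij_betw_detached_cycle_marked_multi_cycle:
  "bij_betw (\<lambda>(\<gamma>, p). (insert (cycle_class p) \<gamma>, p)) {x \<in> decorated n. detached_cycle x}
     (Sigma (multi_cycles_of_length n) \<Union>)"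
proof (rule bij_betwI[where g = "\<lambda>(\<delta>, p). (\<delta> - {cycle_class p}, p)"])
  have good: "\<gamma> \<in> multi_cycles G \<and> cycle p \<and> tail G ` set p \<inter> support \<gamma> = {}"
    if "(\<gamma>, p) \<in> decorated n" "detached_cycle (\<gamma>, p)" for \<gamma> p
    using that by (simp add: decorated_def detached_cycle_def cycle_iff)
  show "(\<lambda>(\<gamma>, p). (insert (cycle_class p) \<gamma>, p)) \<in> {x \<in> decorated n. detached_cycle x} \<rightarrow>
     Sigma (multi_cycles_of_length n) \<Union>"
  proof (rule funcsetI)
    fix x assume x: "x \<in> {x \<in> decorated n. detached_cycle x}"
    obtain \<gamma> p where eq: "x = (\<gamma>, p)" by (cases x)
    have *: "(\<gamma>, p) \<in> decorated n" "detached_cycle (\<gamma>, p)" using x by (simp_all add: eq)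
    from good[OF *] have g: "\<gamma> \<in> multi_cycles G" "cycle p" "tail G ` set p \<inter> support \<gamma> = {}" by auto
    have "insert (cycle_class p) \<gamma> \<in> multi_cycles_of_length n"
      using insert_multi_cycle[OF g] * by (simp add: multi_cycles_of_length_def decorated_def)
    then show "(case x of (\<gamma>, p) \<Rightarrow> (insert (cycle_class p) \<gamma>, p)) \<in>
        Sigma (multi_cycles_of_length n) \<Union>"
      using self_in_cycle_class by (auto simp: eq)
  qed
  have marked: "cycle_class p \<in> \<delta> \<and> cycle p" if "\<delta> \<in> multi_cycles_of_length n" "p \<in> \<Union> \<delta>" for \<delta> p
  proof -
    from that obtain c where c: "c \<in> \<delta>" "p \<in> c" "c \<in> simple_cycles G"
      by (auto simp: multi_cycles_of_length_def multi_cycles_def)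
    then obtain q where q: "cycle q" "c = cycle_class q" by (auto simp: simple_cycles_eq)
    then show ?thesis using c cycle_class_eq[of p q] cycle_of_class[of q p] by simp
  qed
  show "(\<lambda>(\<delta>, p). (\<delta> - {cycle_class p}, p)) \<in> Sigma (multi_cycles_of_length n) \<Union> \<rightarrow>
     {x \<in> decorated n. detached_cycle x}"
  proof (rule funcsetI)
    fix x assume x: "x \<in> Sigma (multi_cycles_of_length n) \<Union>"
    obtain \<delta> p where eq: "x = (\<delta>, p)" by (cases x)
    have *: "\<delta> \<in> multi_cycles_of_length n" "p \<in> \<Union> \<delta>" using x by (simp_all add: eq)
    from marked[OF *] have m: "cycle_class p \<in> \<delta>" "cycle p" by auto
    have \<delta>: "\<delta> \<in> multi_cycles G" "multi_cycle_length \<delta> = n"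
      using * by (auto simp: multi_cycles_of_length_def)
    have rem: "\<delta> - {cycle_class p} \<in> multi_cycles G"
      "tail G ` set p \<inter> support (\<delta> - {cycle_class p}) = {}"
      using remove_multi_cycle[OF \<delta>(1) m(1)] by (simp_all add: cycle_support_class)
    have ins: "insert (cycle_class p) (\<delta> - {cycle_class p}) = \<delta>" using m by auto
    show "(case x of (\<delta>, p) \<Rightarrow> (\<delta> - {cycle_class p}, p)) \<in> {x \<in> decorated n. detached_cycle x}"
      using rem m(2) \<delta>(2) insert_multi_cycle(3)[OF rem(1) m(2) rem(2)] unfolding ins
      by (simp add: eq decorated_def detached_cycle_def cycle_iff)
  qed
  show "(\<lambda>(\<delta>, p). (\<delta> - {cycle_class p}, p)) ((\<lambda>(\<gamma>, p). (insert (cycle_class p) \<gamma>, p)) x) = x"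
    if x: "x \<in> {x \<in> decorated n. detached_cycle x}" for x
  proof -
    obtain \<gamma> p where eq: "x = (\<gamma>, p)" by (cases x)
    show ?thesis using good[of \<gamma> p] insert_multi_cycle(1)[of \<gamma> p] x by (simp add: eq)
  qed
  show "(\<lambda>(\<gamma>, p). (insert (cycle_class p) \<gamma>, p)) ((\<lambda>(\<delta>, p). (\<delta> - {cycle_class p}, p)) x) = x"
    if x: "x \<in> Sigma (multi_cycles_of_length n) \<Union>" for x
  proof -
    obtain \<delta> p where eq: "x = (\<delta>, p)" by (cases x)
    show ?thesis using marked[of \<delta> p] x by (auto simp: eq)
  qed
qed

lemma cycle_length_pos: "c \<in> simple_cycles G \<Longrightarrow> 0 < cycle_length c"
  by (auto simp: simple_cycles_eq cycle_length_class cycle_nonempty)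

lemma card_simple_cycle: "c \<in> simple_cycles G \<Longrightarrow> finite c \<and> card c = cycle_length c"
  by (auto simp: simple_cycles_eq cycle_length_class finite_cycle_class card_cycle_class
      cycle_nonempty cycle_iff distinct_map intro!: card_cycle_class)

lemma simple_cycles_disjoint:
  assumes "c \<in> simple_cycles G" "d \<in> simple_cycles G" "c \<noteq> d"
  shows "c \<inter> d = {}"
proof (rule ccontr)
  assume "c \<inter> d \<noteq> {}"
  then obtain p where p: "p \<in> c" "p \<in> d" by blast
  from assms obtain q r where "c = cycle_class q" "d = cycle_class r" by (auto simp: simple_cycles_eq)
  then have "c = cycle_class p" "d = cycle_class p" using p by (metis cycle_class_eq)+
  then show False using assms(3) by simp
qed

text \<open>
  A component of length \<open>k\<close> has \<open>k\<close> rotations, one for each vertex.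
\<close>

lemma card_marked_multi_cycle:
  assumes "\<gamma> \<in> multi_cycles G"
  shows "finite (\<Union> \<gamma>)" "card (\<Union> \<gamma>) = multi_cycle_length \<gamma>"
proof -
  have \<gamma>: "finite \<gamma>" "\<And>c. c \<in> \<gamma> \<Longrightarrow> c \<in> simple_cycles G" using assms by (auto simp: multi_cycles_def)
  then show "finite (\<Union> \<gamma>)" using card_simple_cycle by auto
  have "card (\<Union> \<gamma>) = (\<Sum>c\<in>\<gamma>. card c)"
  proof (rule card_Union_disjoint)
    show "pairwise disjnt \<gamma>" using \<gamma>(2) simple_cycles_disjoint by (auto simp: pairwise_def disjnt_def)
  qed (use \<gamma> card_simple_cycle in auto)
  then show "card (\<Union> \<gamma>) = multi_cycle_length \<gamma>"
    using \<gamma>(2) card_simple_cycle by (simp add: multi_cycle_length_def)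
qed

context
  assumes bounded: "bounded_cycles G"
begin

lemma finite_simple_cycles_up_to: "finite {c \<in> simple_cycles G. cycle_length c \<le> n}"
proof -
  have "{c \<in> simple_cycles G. cycle_length c \<le> n} \<subseteq> (\<Union>k\<in>{1..n}. {c \<in> simple_cycles G. cycle_length c = k})"
    using cycle_length_pos by force
  moreover have "finite (\<Union>k\<in>{1..n}. {c \<in> simple_cycles G. cycle_length c = k})"
    using bounded by (auto simp: bounded_cycles_def)
  ultimately show ?thesis by (rule finite_subset)
qed

lemma finite_multi_cycles_of_length: "finite (multi_cycles_of_length n)"
proof (rule finite_subset)
  show "multi_cycles_of_length n \<subseteq> Pow {c \<in> simple_cycles G. cycle_length c \<le> n}"
  proof
    fix \<gamma> assume \<gamma>: "\<gamma> \<in> multi_cycles_of_length n"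
    have "cycle_length c \<le> n" if "c \<in> \<gamma>" for c
      using \<gamma> member_le_sum[of c \<gamma> cycle_length] that
      by (auto simp: multi_cycles_of_length_def multi_cycles_def multi_cycle_length_def)
    then show "\<gamma> \<in> Pow {c \<in> simple_cycles G. cycle_length c \<le> n}"
      using \<gamma> by (auto simp: multi_cycles_of_length_def multi_cycles_def)
  qed
qed (simp add: finite_simple_cycles_up_to)

lemma finite_walks_from: "finite {p. length p = n \<and> (\<exists>v. awalk w p v)}"
proof (induction n arbitrary: w)
  case 0
  have "{p. length p = 0 \<and> (\<exists>v. awalk w p v)} \<subseteq> {[]}" by auto
  then show ?case by (rule finite_subset) simp
next
  case (Suc n)
  show ?case
  proof (cases "w \<in> verts G")
    case True
    then have "finite (out_arcs G w)" using bounded by (auto simp: bounded_cycles_def)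
    moreover have "{p. length p = Suc n \<and> (\<exists>v. awalk w p v)} \<subseteq>
        (\<Union>e\<in>out_arcs G w. (#) e ` {p. length p = n \<and> (\<exists>v. awalk (head G e) p v)})"
    proof
      fix p assume "p \<in> {p. length p = Suc n \<and> (\<exists>v. awalk w p v)}"
      then obtain e q v where p: "p = e # q" "length q = n" "awalk w (e # q) v"
        by (cases p) auto
      then have "e \<in> out_arcs G w" "awalk (head G e) q v" by (auto simp: awalk_Cons_iff)
      then show "p \<in> (\<Union>e\<in>out_arcs G w. (#) e ` {p. length p = n \<and> (\<exists>v. awalk (head G e) p v)})"
        using p(1,2) by blast
    qed
    ultimately show ?thesis using Suc.IH by (meson finite_UN_I finite_imageI finite_subset)
  next
    case False
    then have "{p. length p = Suc n \<and> (\<exists>v. awalk w p v)} = {}" using awalk_hd_in_verts by auto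
    then show ?thesis by (simp only: finite.emptyI)
  qed
qed

text \<open>
  A closed path of length \<open>n\<close> starts on a simple cycle of length at most \<open>n\<close>. There are finitely many
  of these, and each of their vertices is the start of finitely many walks of length \<open>n\<close>.
\<close>

lemma finite_closed_paths: "finite (closed_paths G n)"
proof (rule finite_subset)
  let ?W = "\<Union>c\<in>{c \<in> simple_cycles G. cycle_length c \<le> n}. cycle_support G c"
  show "closed_paths G n \<subseteq> (\<Union>w\<in>?W. {p. length p = n \<and> (\<exists>v. awalk w p v)})"
  proof
    fix p assume "p \<in> closed_paths G n"
    then have p: "closed_walk p" "length p = n" by (auto simp: mem_closed_paths_iff)
    obtain q where q: "cycle q" "tail G (hd q) = tail G (hd p)" "length q \<le> length p"
      using simple_cycle_through[OF p(1)] by blast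
    have "tail G (hd p) \<in> cycle_support G (cycle_class q)"
      using q cycle_nonempty[OF q(1)] hd_in_set[of q] by (auto simp: cycle_support_class simp flip: q(2))
    then have "tail G (hd p) \<in> ?W"
      using q p cycle_class_mem_simple_cycles[OF q(1)] by (auto simp: cycle_length_class)
    moreover have "\<exists>v. awalk (tail G (hd p)) p v"
      using p(1) awalk_tail_hd by (auto simp: closed_walk_def)
    ultimately show "p \<in> (\<Union>w\<in>?W. {p. length p = n \<and> (\<exists>v. awalk w p v)})" using p(2) by blast
  qed
  have "finite (cycle_support G c)" if "c \<in> simple_cycles G" for c
    using that by (auto simp: simple_cycles_eq cycle_support_class)
  then show "finite (\<Union>w\<in>?W. {p. length p = n \<and> (\<exists>v. awalk w p v)})"
    using finite_simple_cycles_up_to[of n] finite_walks_from by blast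
qed

lemma decorated_eq_Sigma:
  "decorated n = (\<lambda>(k, \<gamma>, p). (\<gamma>, p)) ` (SIGMA k:{..n}. multi_cycles_of_length (n - k) \<times> closed_paths G k)"
proof (intro set_eqI iffI)
  fix x assume x: "x \<in> decorated n"
  obtain \<gamma> p where "x = (\<gamma>, p)" by (cases x)
  then show "x \<in> (\<lambda>(k, \<gamma>, p). (\<gamma>, p)) ` (SIGMA k:{..n}. multi_cycles_of_length (n - k) \<times> closed_paths G k)"
    using x by (intro image_eqI[of _ _ "(length p, \<gamma>, p)"])
      (auto simp: decorated_def multi_cycles_of_length_def mem_closed_paths_iff)
qed (auto simp: decorated_def multi_cycles_of_length_def mem_closed_paths_iff)

lemma finite_decorated: "finite (decorated n)"
  unfolding decorated_eq_Sigma
  by (intro finite_imageI finite_SigmaI) (simp_all add: finite_multi_cycles_of_length finite_closed_paths)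

text \<open>
  Summing \<open>(- 1) ^ card \<gamma>\<close> over all pairs \<open>(\<gamma>, p)\<close> of total length \<open>n\<close>: moving a cycle between \<open>\<gamma>\<close>
  and \<open>p\<close> flips the sign, so only pairs with a detached simple cycle remain. Merging that cycle into
  \<open>\<gamma>\<close> flips the sign once more and leaves each multi-cycle of length \<open>n\<close> with \<open>n\<close> marks.
\<close>

lemma newton_identity:
  "(\<Sum>k\<le>n. of_nat (card (closed_paths G k)) * multi_cycle_coeff (n - k)) = - of_nat n * multi_cycle_coeff n"
proof -
  let ?s = "\<lambda>(\<gamma>, p :: 'b list). (- 1 :: complex) ^ card (\<gamma> :: 'b list set set)"
  let ?A = "{x \<in> decorated n. enters_support x}" and ?B = "{x \<in> decorated n. closes_loop x}"
    and ?C = "{x \<in> decorated n. detached_cycle x}"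
  have "(\<Sum>k\<le>n. of_nat (card (closed_paths G k)) * multi_cycle_coeff (n - k)) =
      (\<Sum>k\<le>n. \<Sum>x\<in>multi_cycles_of_length (n - k) \<times> closed_paths G k. ?s x)"
    by (simp add: multi_cycle_coeff_def sum.cartesian_product[symmetric] sum_distrib_left)
  also have "\<dots> = (\<Sum>(k, x)\<in>(SIGMA k:{..n}. multi_cycles_of_length (n - k) \<times> closed_paths G k). ?s x)"
    by (rule sum.Sigma) (simp_all add: finite_multi_cycles_of_length finite_closed_paths)
  also have "\<dots> = sum ?s (decorated n)"
    unfolding decorated_eq_Sigma
    by (subst sum.reindex) (auto simp: inj_on_def mem_closed_paths_iff intro!: sum.cong)
  also have "decorated n = (?A \<union> ?B) \<union> ?C" using decorated_cases by auto
  also have "sum ?s \<dots> = (sum ?s ?A + sum ?s ?B) + sum ?s ?C"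
    using finite_decorated decorated_cases_disjoint
    by (subst sum.union_disjoint; (subst sum.union_disjoint)?; auto)
  also have "sum ?s ?A = (\<Sum>(\<gamma>, a, q, b)\<in>spliced n. - ((- 1) ^ card \<gamma>))"
    unfolding sum.reindex_bij_betw[OF bij_betw_spliced_enters_support, symmetric]
  proof (intro sum.cong refl, clarsimp)
    fix \<gamma> a q b assume "(\<gamma>, a, q, b) \<in> spliced n"
    then have "\<gamma> \<in> multi_cycles G" "cycle q" "tail G ` set q \<inter> support \<gamma> = {}"
      by (auto simp: spliced_def)
    from insert_multi_cycle(4)[OF this]
    show "(- 1 :: complex) ^ card (insert (cycle_class q) \<gamma>) = - ((- 1) ^ card \<gamma>)" by simp
  qed
  also have "sum ?s ?B = (\<Sum>(\<gamma>, a, q, b)\<in>spliced n. (- 1) ^ card \<gamma>)"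
    unfolding sum.reindex_bij_betw[OF bij_betw_spliced_closes_loop, symmetric]
    by (intro sum.cong refl) auto
  also have "(\<Sum>(\<gamma>, a, q, b)\<in>spliced n. - ((- 1 :: complex) ^ card \<gamma>)) +
      (\<Sum>(\<gamma>, a, q, b)\<in>spliced n. (- 1) ^ card \<gamma>) = 0"
    by (simp add: sum.distrib[symmetric] split_def)
  also have "sum ?s ?C = (\<Sum>x\<in>Sigma (multi_cycles_of_length n) \<Union>. - ?s x)"
    unfolding sum.reindex_bij_betw[OF bij_betw_detached_cycle_marked_multi_cycle, symmetric]
  proof (intro sum.cong refl, clarsimp)
    fix \<gamma> p assume "(\<gamma>, p) \<in> decorated n" "detached_cycle (\<gamma>, p)"
    then have "\<gamma> \<in> multi_cycles G" "cycle p" "tail G ` set p \<inter> support \<gamma> = {}"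
      by (auto simp: decorated_def detached_cycle_def cycle_iff)
    from insert_multi_cycle(4)[OF this]
    show "(- 1 :: complex) ^ card \<gamma> = - ((- 1) ^ card (insert (cycle_class p) \<gamma>))" by simp
  qed
  also have "\<dots> = (\<Sum>\<gamma>\<in>multi_cycles_of_length n. \<Sum>p\<in>\<Union>\<gamma>. - ((- 1) ^ card \<gamma>))"
  proof (subst sum.Sigma)
    show "\<forall>\<gamma>\<in>multi_cycles_of_length n. finite (\<Union>\<gamma>)"
      using card_marked_multi_cycle(1) by (auto simp: multi_cycles_of_length_def)
  qed (simp_all add: finite_multi_cycles_of_length split_def)
  also have "\<dots> = - of_nat n * multi_cycle_coeff n"
    unfolding multi_cycle_coeff_def sum_distrib_left
    by (intro sum.cong refl) (auto simp: multi_cycles_of_length_def card_marked_multi_cycle)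
  finally show ?thesis by simp
qed

end


section \<open>The power series of multi-cycles and of closed paths\<close>

lemma closed_walk_replicate:
  assumes "closed_walk p" "0 < m"
  shows "closed_walk (concat (replicate m p))"
proof -
  from assms(1) obtain v where v: "awalk v p v" "p \<noteq> []" by (auto simp: closed_walk_def)
  have "awalk v (concat (replicate m p)) v"
  proof (induction m)
    case 0
    then show ?case using awalk_hd_in_verts[OF v(1)] by (simp add: awalk_Nil_iff)
  next
    case (Suc m)
    then show ?case using awalk_append[OF v(1) Suc.IH] by (simp del: awalk_append_iff)
  qed
  moreover have "concat (replicate m p) \<noteq> []" using assms(2) v(2) by (cases m) auto
  ultimately show ?thesis by (auto simp: closed_walk_def)
qed

lemma empty_multi_cycle: "{} \<in> multi_cycles G"
  by (simp add: multi_cycles_def disjoint_family_on_def)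

definition multi_cycle_fps :: "complex fps" where
  "multi_cycle_fps = Abs_fps multi_cycle_coeff"

text \<open>
  The logarithm of the zeta function of the graph. The coefficient at \<open>n = 0\<close> is \<open>0\<close>, by \<open>x / 0 = 0\<close>.
\<close>

definition log_zeta_fps :: "complex fps" where
  "log_zeta_fps = Abs_fps (\<lambda>n. of_real (card (closed_paths G n) / n))"

context
  assumes bounded: "bounded_cycles G" and subexp: "multi_cycle_growth_rate G \<le> 1"
begin

lemma conv_radius_card_multi_cycles:
  "conv_radius (\<lambda>n. complex_of_nat (card (multi_cycles_of_length n))) \<ge> 1"
proof -
  have "inverse (multi_cycle_growth_rate G) \<ge> inverse 1"
  proof (rule ereal_inverse_antimono[OF _ subexp])
    have "0 = limsup (\<lambda>n. 0 :: ereal)" by (simp add: Limsup_const)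
    also have "\<dots> \<le> multi_cycle_growth_rate G" unfolding multi_cycle_growth_rate_def
      by (intro Limsup_mono) (simp add: real_root_ge_zero)
    finally show "0 \<le> multi_cycle_growth_rate G" .
  qed
  then show ?thesis
    by (simp add: conv_radius_def multi_cycle_growth_rate_def multi_cycles_of_length_def one_ereal_def)
qed

lemma conv_radius_multi_cycle_fps: "fps_conv_radius multi_cycle_fps \<ge> 1"
proof -
  have "norm (multi_cycle_coeff n) \<le> norm (complex_of_nat (card (multi_cycles_of_length n)))" for n
  proof -
    have "norm (multi_cycle_coeff n) \<le> (\<Sum>\<gamma>\<in>multi_cycles_of_length n. norm ((- 1 :: complex) ^ card \<gamma>))"
      unfolding multi_cycle_coeff_def by (rule norm_sum)
    then show ?thesis by (simp add: norm_power)
  qed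
  from order_trans[OF conv_radius_card_multi_cycles conv_radius_mono_norm[OF this]]
  show ?thesis by (simp add: fps_conv_radius_def multi_cycle_fps_def)
qed

lemma multi_cycle_fps_0: "fps_nth multi_cycle_fps 0 = 1"
proof -
  have "multi_cycles_of_length 0 = {{}}"
  proof (intro set_eqI iffI)
    fix \<gamma> assume "\<gamma> \<in> multi_cycles_of_length 0"
    then have \<gamma>: "\<gamma> \<subseteq> simple_cycles G" "\<forall>c\<in>\<gamma>. cycle_length c = 0"
      by (auto simp: multi_cycles_of_length_def multi_cycle_length_def multi_cycles_def)
    then have "c \<notin> \<gamma>" for c using cycle_length_pos[of c] by auto
    then show "\<gamma> \<in> {{}}" by auto
  qed (simp add: multi_cycles_of_length_def empty_multi_cycle multi_cycle_length_def)
  then show ?thesis by (simp add: multi_cycle_fps_def multi_cycle_coeff_def)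
qed

lemma fps_deriv_log_zeta_nth: "fps_nth (fps_deriv log_zeta_fps) n = of_nat (card (closed_paths G (Suc n)))"
  by (simp add: log_zeta_fps_def del: of_nat_Suc)

text \<open>
  Newton's identities, read as an identity of generating functions.
\<close>

lemma fps_deriv_multi_cycle_fps:
  "fps_deriv multi_cycle_fps = - (multi_cycle_fps * fps_deriv log_zeta_fps)"
proof (rule fps_ext)
  fix n
  let ?c = "\<lambda>k. complex_of_nat (card (closed_paths G k))"
  have "closed_paths G 0 = {}" by (auto simp: closed_paths_def)
  then have "(\<Sum>k\<le>Suc n. ?c k * multi_cycle_coeff (Suc n - k)) = (\<Sum>k\<le>n. ?c (Suc k) * multi_cycle_coeff (n - k))"
    by (subst sum.atMost_Suc_shift) simp
  also have "\<dots> = fps_nth (fps_deriv log_zeta_fps * multi_cycle_fps) n"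
    unfolding fps_mult_nth fps_deriv_log_zeta_nth by (simp add: multi_cycle_fps_def atLeast0AtMost)
  finally show "fps_nth (fps_deriv multi_cycle_fps) n = fps_nth (- (multi_cycle_fps * fps_deriv log_zeta_fps)) n"
    using newton_identity[OF bounded, of "Suc n"]
    by (simp add: multi_cycle_fps_def mult.commute[of "fps_deriv _"] del: of_nat_Suc)
qed

text \<open>
  Dividing the coefficient of degree \<open>n\<close> by \<open>n\<close> does not change the radius, which is the inverse of
  the growth rate by the Cauchy-Hadamard formula.
\<close>

lemma conv_radius_log_zeta:
  "fps_conv_radius (fps_deriv log_zeta_fps) = inverse (growth_rate G)"
  "fps_conv_radius log_zeta_fps = inverse (growth_rate G)"
proof -
  let ?c = "\<lambda>n. complex_of_nat (card (closed_paths G n))"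
  have c: "conv_radius ?c = inverse (growth_rate G)"
    by (simp add: conv_radius_def growth_rate_def)
  show deriv: "fps_conv_radius (fps_deriv log_zeta_fps) = inverse (growth_rate G)"
    using conv_radius_shift[of ?c 1] unfolding fps_conv_radius_def fps_deriv_log_zeta_nth[abs_def]
    by (simp add: c del: fps_deriv_nth)
  have "norm (fps_nth log_zeta_fps n) \<le> norm (?c n)" for n
    by (cases "n = 0") (simp_all add: log_zeta_fps_def norm_divide divide_le_eq mult_le_cancel_left1)
  from conv_radius_mono_norm[of "fps_nth log_zeta_fps" ?c, OF this] have "inverse (growth_rate G) \<le> fps_conv_radius log_zeta_fps"
    by (simp add: fps_conv_radius_def c)
  then show "fps_conv_radius log_zeta_fps = inverse (growth_rate G)"
    using fps_conv_radius_deriv[of log_zeta_fps] deriv by simp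
qed

text \<open>
  The family indexed by multi-cycles is absolutely summable because the series of the numbers of
  multi-cycles of length \<open>n\<close> has radius at least \<open>1\<close>; it may therefore be summed by length first.
\<close>

lemma multi_cycle_series_eq_eval_fps:
  assumes z: "norm z < 1"
  shows "multi_cycle_term z summable_on multi_cycles G"
    and "multi_cycle_series G z = eval_fps multi_cycle_fps z"
proof -
  let ?f = "\<lambda>(n :: nat, \<gamma>). multi_cycle_term z \<gamma>"
  let ?S = "Sigma UNIV multi_cycles_of_length"
  have bij: "bij_betw snd ?S (multi_cycles G)"
    by (rule bij_betwI[where g = "\<lambda>\<gamma>. (multi_cycle_length \<gamma>, \<gamma>)"])
      (auto simp: multi_cycles_of_length_def)
  have f_eq: "?f = (\<lambda>x. multi_cycle_term z (snd x))" by (simp add: split_def)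
  note fin = finite_multi_cycles_of_length[OF bounded]
  have norm_term: "norm (multi_cycle_term z \<gamma>) = norm z ^ n" if "\<gamma> \<in> multi_cycles_of_length n" for n \<gamma>
    using that by (simp add: multi_cycle_term_def multi_cycles_of_length_def norm_mult norm_power)
  have "ereal (norm z) < conv_radius (\<lambda>n. complex_of_nat (card (multi_cycles_of_length n)))"
    by (rule less_le_trans[OF _ conv_radius_card_multi_cycles]) (simp add: z one_ereal_def)
  from abs_summable_in_conv_radius[OF this]
  have sm: "summable (\<lambda>n. real (card (multi_cycles_of_length n)) * norm z ^ n)"
    by (simp add: norm_mult norm_power)
  have "(\<lambda>x. norm (?f x)) summable_on ?S"
  proof (rule Infinite_Sum.abs_summable_on_Sigma_iff[THEN iffD2], intro conjI ballI)
    fix n show "(\<lambda>\<gamma>. norm (?f (n, \<gamma>))) summable_on multi_cycles_of_length n"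
      using fin by (intro summable_on_finite)
    have "(\<Sum>\<^sub>\<infinity>\<gamma>\<in>multi_cycles_of_length n. norm (?f (n, \<gamma>))) =
        real (card (multi_cycles_of_length n)) * norm z ^ n" for n
      using fin by (simp add: norm_term)
    then show "(\<lambda>n. norm (\<Sum>\<^sub>\<infinity>\<gamma>\<in>multi_cycles_of_length n. norm (?f (n, \<gamma>)))) summable_on UNIV"
      using sm by (simp add: summable_on_UNIV_nonneg_real_iff)
  qed
  then have sumf: "?f summable_on ?S" by (rule Infinite_Sum.abs_summable_summable)
  then show "multi_cycle_term z summable_on multi_cycles G"
    using summable_on_reindex_bij_betw[OF bij, of "multi_cycle_term z"] unfolding f_eq by simp
  have inner: "(\<Sum>\<^sub>\<infinity>\<gamma>\<in>multi_cycles_of_length n. ?f (n, \<gamma>)) = fps_nth multi_cycle_fps n * z ^ n" for n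
    using fin
    by (simp add: multi_cycle_fps_def multi_cycle_coeff_def sum_distrib_right
        multi_cycle_term_def multi_cycles_of_length_def)
  have "multi_cycle_series G z = infsum ?f ?S"
    unfolding multi_cycle_series_def f_eq by (rule infsum_reindex_bij_betw[OF bij, symmetric])
  also have "\<dots> = (\<Sum>\<^sub>\<infinity>n. fps_nth multi_cycle_fps n * z ^ n)"
    unfolding infsum_Sigma_banach[OF sumf, symmetric] inner ..
  also have "\<dots> = (\<Sum>n. fps_nth multi_cycle_fps n * z ^ n)"
  proof -
    have "(\<lambda>n. fps_nth multi_cycle_fps n * z ^ n) summable_on UNIV"
      using summable_on_Sigma_banach[of "\<lambda>n. multi_cycle_term z" UNIV multi_cycles_of_length] sumf inner
      by simp
    then show ?thesis by (metis has_sum_imp_sums has_sum_infsum sums_unique)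
  qed
  finally show "multi_cycle_series G z = eval_fps multi_cycle_fps z" by (simp add: eval_fps_def)
qed

text \<open>
  If the series of the numbers of closed paths converges at \<open>1\<close>, these integers are eventually zero. But
  repeating a closed path yields arbitrarily long ones, so there are none.
\<close>

lemma multi_cycles_trivial_if_growth_rate_lt_1:
  assumes "inverse (growth_rate G) > 1"
  shows "multi_cycles G = {{}}"
proof -
  let ?c = "\<lambda>n. complex_of_nat (card (closed_paths G n))"
  have "conv_radius ?c > ereal (norm (1 :: complex))"
    using assms by (simp add: conv_radius_def growth_rate_def one_ereal_def)
  then have "?c \<longlonglongrightarrow> 0"
    using summable_in_conv_radius[of 1 ?c] by (auto intro: summable_LIMSEQ_zero)
  then have "eventually (\<lambda>n. norm (?c n) < 1) sequentially"
    by (intro order_tendstoD(2)[OF tendsto_norm_zero]) simp_all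
  then obtain N where N: "\<And>n. n \<ge> N \<Longrightarrow> card (closed_paths G n) = 0"
    by (auto simp: eventually_sequentially)
  have "\<not> closed_walk p" for p
  proof
    assume p: "closed_walk p"
    then have "length p \<ge> 1" by (simp add: closed_walk_def Suc_le_eq)
    then have "Suc N * length p \<ge> N" by (metis Suc_leD mult_le_mono2 nat_mult_1_right order_trans le_refl)
    moreover have "concat (replicate (Suc N) p) \<in> closed_paths G (Suc N * length p)"
      using closed_walk_replicate[OF p, of "Suc N"]
      by (simp add: mem_closed_paths_iff length_concat sum_list_replicate)
    ultimately show False
      using N[of "Suc N * length p"] finite_closed_paths[OF bounded, of "Suc N * length p"] by auto
  qed
  then have "simple_cycles G = {}" by (simp add: simple_cycles_eq cycle_iff)
  then show ?thesis using empty_multi_cycle by (auto simp: multi_cycles_def)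
qed

lemma multi_cycle_series_nonzero:
  assumes "ereal (norm z) < inverse (growth_rate G)"
  shows "multi_cycle_term z summable_on multi_cycles G \<and> multi_cycle_series G z \<noteq> 0"
proof (cases "norm z < 1")
  case True
  then have "ereal (norm z) < fps_conv_radius multi_cycle_fps"
    by (intro less_le_trans[OF _ conv_radius_multi_cycle_fps]) (simp add: one_ereal_def)
  then have "eval_fps multi_cycle_fps z * exp (eval_fps log_zeta_fps z) = 1"
    using assms conv_radius_log_zeta(2)
    by (intro fps_mult_exp_eq_1 multi_cycle_fps_0 fps_deriv_multi_cycle_fps) (simp_all add: log_zeta_fps_def)
  then show ?thesis using multi_cycle_series_eq_eval_fps[OF True] by auto
next
  case False
  then have "inverse (growth_rate G) > 1"
    using le_less_trans[OF _ assms, of 1] by (simp add: one_ereal_def)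
  then have "multi_cycles G = {{}}" by (rule multi_cycles_trivial_if_growth_rate_lt_1)
  then show ?thesis
    by (simp add: multi_cycle_series_def multi_cycle_term_def multi_cycle_length_def)
qed

lemma multi_cycle_series_zero:
  assumes "growth_rate G > 1"
  shows "multi_cycle_series G (of_real (real_of_ereal (inverse (growth_rate G)))) = 0"
proof -
  \<comment> \<open>An infinite growth rate gives \<open>R = 0\<close>. The lemma \<open>eval_fps_zero_at_conv_radius\<close> covers that case: its assumptions are then contradictory.\<close>
  obtain R where R: "inverse (growth_rate G) = ereal R" "0 \<le> R" "R < 1"
  proof (cases "growth_rate G")
    case (real r)
    then show ?thesis using assms that[of "inverse r"] by (auto simp: one_ereal_def field_simps)
  qed (use assms that[of 0] in auto)
  have "eval_fps multi_cycle_fps (of_real R) = 0"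
  proof (rule eval_fps_zero_at_conv_radius[OF multi_cycle_fps_0 _ fps_deriv_multi_cycle_fps])
    show "ereal R < fps_conv_radius multi_cycle_fps"
      by (rule less_le_trans[OF _ conv_radius_multi_cycle_fps]) (simp add: R(3) one_ereal_def)
    show "fps_nth log_zeta_fps n = of_real (card (closed_paths G n) / n)" for n
      by (simp add: log_zeta_fps_def)
    show "fps_nth log_zeta_fps 0 = 0" by (simp add: log_zeta_fps_def)
  qed (simp_all add: conv_radius_log_zeta R(1))
  then show ?thesis
    using R by (simp add: multi_cycle_series_eq_eval_fps)
qed

end

end

theorem theorem2p3:
  fixes G :: "('a, 'b) pre_digraph"
  assumes "wf_digraph G"
    and "countable (verts G)"
    and "bounded_cycles G"
    and "multi_cycle_growth_rate G \<le> 1"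
  shows "(\<forall>z\<in>ball 0 1. multi_cycle_term z summable_on multi_cycles G) \<and>
    multi_cycle_series G holomorphic_on ball 0 1 \<and>
    (\<forall>z. ereal (norm z) < inverse (growth_rate G) \<longrightarrow>
      multi_cycle_term z summable_on multi_cycles G \<and> multi_cycle_series G z \<noteq> 0) \<and>
    (growth_rate G > 1 \<longrightarrow>
      multi_cycle_series G (complex_of_real (real_of_ereal (inverse (growth_rate G)))) = 0)"
proof -
  interpret wf_digraph G by fact
  note series = multi_cycle_series_eq_eval_fps[OF assms(3,4)]
  have "eval_fps multi_cycle_fps holomorphic_on ball 0 1"
  proof (rule holomorphic_on_eval_fps, rule subsetI)
    fix z :: complex assume "z \<in> ball 0 1"
    then show "z \<in> eball 0 (fps_conv_radius multi_cycle_fps)"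
      using conv_radius_multi_cycle_fps[OF assms(3,4)]
      by (auto simp: in_eball_iff one_ereal_def intro: less_le_trans[of _ "ereal 1"])
  qed
  then have "multi_cycle_series G holomorphic_on ball 0 1"
    by (rule holomorphic_transform) (simp add: series(2))
  then show ?thesis
    using series(1) multi_cycle_series_nonzero[OF assms(3,4)] multi_cycle_series_zero[OF assms(3,4)]
    by simp
qed

end
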